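(* For any block design $\mathcal D$, the set of equivalence classes $\mathcal P(\mathcal D)$ is symmetric. In particular, if $\mathcal P(\mathcal D)$ is a system of pairs, then it is a symmetric system of pairs.
   Context: A block design with parameters $(v,b,r,k,\lambda)$ (with $b,r,k,\lambda$ positive integers and $k<v$) on a finite set $V$ with $|V|=v$ is a collection (repetitions allowed) of $b$ blocks $B_1,\dots,B_b$, each a $k$-element subset of $V$, such that every element of $V$ lies in exactly $r$ blocks and every pair of distinct elements of $V$ is contained in exactly $\lambda$ blocks. For an unordered pair $\{x,y\}$ of distinct elements of $V$, let $\mathcal Z^+(x,y)\in\{0,1\}^b$ be the vector with $j$th entry $|\chi_{B_j}(x)-\chi_{B_j}(y)|$, where $\chi_B$ is the characteristic function of $B$. Two unordered pairs are equivalent with respect to $\mathcal D$, written $\{x,y\}\sim_{\mathcal D}\{\alpha,\beta\}$, if $\mathcal Z^+(x,y)=\mathcal Z^+(\alpha,\beta)$. The set of equivalence classes of $\sim_{\mathcal D}$ on the set of unordered pairs of distinct elements of $V$ is denoted $\mathcal P(\mathcal D)=\{\mathcal P_1(\mathcal D),\dots,\mathcal P_n(\mathcal D)\}$. $\mathcal P(\mathcal D)$ is called symmetric if for any two distinct unordered pairs $\{x,y\}$ and $\{\alpha,\beta\}$ belonging to the same class $\mathcal P_l(\mathcal D)$ there exist classes $\mathcal P_i(\mathcal D)$ and $\mathcal P_j(\mathcal D)$ such that $\mathcal P_i(\mathcal D)$ contains $\{x,\alpha\}$ and $\{y,\beta\}$ while $\mathcal P_j(\mathcal D)$ contains $\{x,\beta\}$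 and $\{y,\alpha\}$. A system of pairs with parameters $(v,n,t)$ on $V$ is a partition of all $\frac{v(v-1)}2$ unordered pairs of distinct elements of $V$ into $n$ families (subsystems) of $t$ pairs each ($n,t\geqslant1$, $nt=\frac{v(v-1)}2$) such that no subsystem contains any element of $V$ more than once. A system of pairs is symmetric if for any two distinct unordered pairs $\{x,y\}$ and $\{\alpha,\beta\}$ belonging to the same subsystem there exist a subsystem containing both $\{x,\alpha\}$ and $\{y,\beta\}$ and a subsystem containing both $\{x,\beta\}$ and $\{y,\alpha\}$. Saying that $\mathcal P(\mathcal D)$ is a system of pairs means that its classes are the subsystems of a system of pairs. *)

theory Defs
  imports "HOL-Library.Ramsey" "HOL-Library.Disjoint_Sets" "HOL-Library.Indicator_Function"
begin

(* The blocks form a list, so repeated blocks are allowed and are counted with multiplicity. *)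
locale block_design =
  fixes V :: "'a set" and Bs :: "'a set list" and v b r k \<Lambda> :: nat
  assumes finite_V: "finite V"
    and card_V: "card V = v"
    and length_blocks: "length Bs = b"
    and b_pos: "b > 0" and r_pos: "r > 0" and k_pos: "k > 0" and lambda_pos: "\<Lambda> > 0"
    and k_less_v: "k < v"
    and block_subset: "\<And>B. B \<in> set Bs \<Longrightarrow> B \<subseteq> V"
    and block_card: "\<And>B. B \<in> set Bs \<Longrightarrow> card B = k"
    and replication: "\<And>x. x \<in> V \<Longrightarrow> length (filter (\<lambda>B. x \<in> B) Bs) = r"
    and balance: "\<And>x y. \<lbrakk>x \<in> V; y \<in> V; x \<noteq> y\<rbrakk> \<Longrightarrow>
                    length (filter (\<lambda>B. x \<in> B \<and> y \<in> B) Bs) = \<Lambda>"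

(* Throughout, the unordered pairs of distinct elements of V are the two-element
   subsets nsets V 2, so {x, x} is never a pair. *)

definition Z_plus :: "'a set list \<Rightarrow> 'a \<Rightarrow> 'a \<Rightarrow> int list" where
  "Z_plus Bs x y = map (\<lambda>B. \<bar>indicator B x - indicator B y\<bar>) Bs"

lemma Z_plus_commute: "Z_plus Bs x y = Z_plus Bs y x"
  by (simp add: Z_plus_def abs_minus_commute)

definition pair_equiv :: "'a set \<Rightarrow> 'a set list \<Rightarrow> ('a set \<times> 'a set) set" where
  "pair_equiv V Bs = {(p, q). p \<in> nsets V 2 \<and> q \<in> nsets V 2 \<and>
     (\<exists>x y \<alpha> \<beta>. p = {x, y} \<and> q = {\<alpha>, \<beta>} \<and> Z_plus Bs x y = Z_plus Bs \<alpha> \<beta>)}"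

(* The choice of the order of x, y and of \<alpha>, \<beta> in pair_equiv is immaterial. *)
lemma pair_equiv_iff:
  "({x, y}, {\<alpha>, \<beta>}) \<in> pair_equiv V Bs \<longleftrightarrow>
     {x, y} \<in> nsets V 2 \<and> {\<alpha>, \<beta>} \<in> nsets V 2 \<and> Z_plus Bs x y = Z_plus Bs \<alpha> \<beta>"
  unfolding pair_equiv_def by (auto simp: doubleton_eq_iff Z_plus_commute)

lemma equiv_pair_equiv: "equiv (nsets V 2) (pair_equiv V Bs)"
proof (rule equivI)
  show "pair_equiv V Bs \<subseteq> nsets V 2 \<times> nsets V 2"
    by (auto simp: pair_equiv_def)
  show "refl_on (nsets V 2) (pair_equiv V Bs)"
    by (auto simp: refl_on_def pair_equiv_def nsets_2_eq)
  show "sym (pair_equiv V Bs)"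
    unfolding sym_def pair_equiv_def by (clarsimp, metis)
  show "trans (pair_equiv V Bs)"
  proof (rule transI)
    fix p q s assume "(p, q) \<in> pair_equiv V Bs" and qs: "(q, s) \<in> pair_equiv V Bs"
    then obtain x y \<alpha> \<beta> \<gamma> \<delta> where "p = {x, y}" "q = {\<alpha>, \<beta>}" "s = {\<gamma>, \<delta>}"
      and "({x, y}, {\<alpha>, \<beta>}) \<in> pair_equiv V Bs"
      unfolding pair_equiv_def by blast
    with qs show "(p, s) \<in> pair_equiv V Bs"
      by (simp add: pair_equiv_iff)
  qed
qed

definition pair_classes :: "'a set \<Rightarrow> 'a set list \<Rightarrow> 'a set set set" where
  "pair_classes V Bs = nsets V 2 // pair_equiv V Bs"

definition symmetric_pairs :: "'a set set set \<Rightarrow> bool" where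
  "symmetric_pairs F \<longleftrightarrow>
     (\<forall>L\<in>F. \<forall>x y \<alpha> \<beta>. {x, y} \<in> L \<and> {\<alpha>, \<beta>} \<in> L \<and> {x, y} \<noteq> {\<alpha>, \<beta>} \<longrightarrow>
        (\<exists>I\<in>F. {x, \<alpha>} \<in> I \<and> {y, \<beta>} \<in> I) \<and>
        (\<exists>J\<in>F. {x, \<beta>} \<in> J \<and> {y, \<alpha>} \<in> J))"

(* "disjoint S" expresses that no element of V occurs in two different pairs of S. *)
definition system_of_pairs ::
    "'a set \<Rightarrow> nat \<Rightarrow> nat \<Rightarrow> nat \<Rightarrow> 'a set set set \<Rightarrow> bool" where
  "system_of_pairs V v n t F \<longleftrightarrow>
     finite V \<and> card V = v \<and> n \<ge> 1 \<and> t \<ge> 1 \<and> n * t = v * (v - 1) div 2 \<and>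
     partition_on (nsets V 2) F \<and> card F = n \<and>
     (\<forall>S\<in>F. card S = t \<and> disjoint S)"

definition symmetric_system_of_pairs ::
    "'a set \<Rightarrow> nat \<Rightarrow> nat \<Rightarrow> nat \<Rightarrow> 'a set set set \<Rightarrow> bool" where
  "symmetric_system_of_pairs V v n t F \<longleftrightarrow> system_of_pairs V v n t F \<and> symmetric_pairs F"

end

(* Equality of the vectors of {x, y} and {\<alpha>, \<beta>} says that on every block
   the sum of the four characteristic values is even, a condition symmetric in the four points.
   It remains to see that distinct equivalent pairs are disjoint, so that {x, \<alpha>} etc. really
   are pairs: if they shared a point, the other two points would lie in the same blocks, forcing
   \<Lambda> = r; but then a block through one point contains every other point, against k < v. *)
theory Submission
  imports Defs
begin

text \<open>Every entry is 0 or 1, and it vanishes exactly when the block contains both points of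
  the pair or neither.\<close>

lemma Z_plus_eq_iff:
  "Z_plus Bs x y = Z_plus Bs \<alpha> \<beta> \<longleftrightarrow>
     (\<forall>B\<in>set Bs. (x \<in> B \<longleftrightarrow> y \<in> B) \<longleftrightarrow> (\<alpha> \<in> B \<longleftrightarrow> \<beta> \<in> B))"
  by (auto simp: Z_plus_def indicator_def)

lemma Z_plus_exchange:
  "Z_plus Bs x y = Z_plus Bs \<alpha> \<beta> \<Longrightarrow> Z_plus Bs x \<alpha> = Z_plus Bs y \<beta>"
  unfolding Z_plus_eq_iff by blast

context block_design
begin

text \<open>All counting with the design parameters happens here; the later lemmas only compare
  memberships.\<close>

lemma blocks_separate_points:
  assumes "y \<in> V" "z \<in> V" "\<And>B. B \<in> set Bs \<Longrightarrow> y \<in> B \<longleftrightarrow> z \<in> B"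
  shows "y = z"
proof (rule ccontr)
  assume "y \<noteq> z"
  have "filter (\<lambda>B. y \<in> B \<and> z \<in> B) Bs = filter (\<lambda>B. y \<in> B) Bs"
    using assms(3) by (intro filter_cong) auto
  then have "\<Lambda> = r"
    using balance[OF assms(1,2) \<open>y \<noteq> z\<close>] replication[OF assms(1)] by simp
  have "filter (\<lambda>B. y \<in> B) Bs \<noteq> []"
    using replication[OF assms(1)] r_pos by force
  then obtain B where B: "B \<in> set Bs" "y \<in> B"
    by (auto simp: filter_empty_conv)
  have "w \<in> B" if "w \<in> V" for w
  proof (rule ccontr)
    assume "w \<notin> B"
    then have "w \<noteq> y" using B by auto
    \<comment> \<open>\<open>B\<close> contains \<open>y\<close> but not \<open>w\<close>, so fewer
      than \<open>r\<close> blocks contain both points, against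
      \<open>\<Lambda> = r\<close>.\<close>
    have "length (filter (\<lambda>C. w \<in> C) (filter (\<lambda>C. y \<in> C) Bs))
            < length (filter (\<lambda>C. y \<in> C) Bs)"
      using B \<open>w \<notin> B\<close> by (intro length_filter_less[of B]) auto
    then show False
      using balance[OF that assms(1) \<open>w \<noteq> y\<close>] replication[OF assms(1)] \<open>\<Lambda> = r\<close>
      by (simp add: conj_commute)
  qed
  then have "B = V" using block_subset[OF B(1)] by auto
  then show False using block_card[OF B(1)] card_V k_less_v by simp
qed

text \<open>With \<open>x\<close> common to both pairs, the condition at each block reduces to
  \<open>y\<close> and \<open>\<beta>\<close> lying in it together or not at all.\<close>

lemma Z_plus_cancel:
  assumes "y \<in> V" "\<beta> \<in> V" "Z_plus Bs x y = Z_plus Bs x \<beta>"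
  shows "y = \<beta>"
  using assms by (intro blocks_separate_points) (auto simp: Z_plus_eq_iff)

lemma pair_equiv_exchange:
  assumes equiv: "({x, y}, {\<alpha>, \<beta>}) \<in> pair_equiv V Bs" and ne: "{x, y} \<noteq> {\<alpha>, \<beta>}"
  shows "({x, \<alpha>}, {y, \<beta>}) \<in> pair_equiv V Bs"
proof -
  have Z: "Z_plus Bs x y = Z_plus Bs \<alpha> \<beta>" and V: "{x, y, \<alpha>, \<beta>} \<subseteq> V"
    using equiv by (auto simp: pair_equiv_iff nsets_def)
  \<comment> \<open>If \<open>x = \<alpha>\<close>, cancelling it gives \<open>y = \<beta>\<close>,
    so the two pairs would coincide.\<close>
  have "x \<noteq> \<alpha>"
    using Z_plus_cancel[of y \<beta> x] Z V ne by auto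
  moreover have "y \<noteq> \<beta>"
    using Z_plus_cancel[of x \<alpha> y] Z V ne by (auto simp: Z_plus_commute)
  ultimately show ?thesis
    using V Z_plus_exchange[OF Z] by (auto simp: pair_equiv_iff nsets_def)
qed

lemma pair_equiv_in_class:
  assumes "(p, q) \<in> pair_equiv V Bs"
  shows "\<exists>I\<in>pair_classes V Bs. p \<in> I \<and> q \<in> I"
proof
  have "p \<in> nsets V 2"
    using assms by (auto simp: pair_equiv_def)
  then show "p \<in> pair_equiv V Bs `` {p} \<and> q \<in> pair_equiv V Bs `` {p}"
    using assms equiv_class_self[OF equiv_pair_equiv] by auto
  show "pair_equiv V Bs `` {p} \<in> pair_classes V Bs"
    unfolding pair_classes_def using \<open>p \<in> nsets V 2\<close> by (rule quotientI)
qed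

lemma symmetric_pair_classes: "symmetric_pairs (pair_classes V Bs)"
  unfolding symmetric_pairs_def
proof (intro ballI allI impI, elim conjE)
  fix L x y \<alpha> \<beta>
  assume "L \<in> pair_classes V Bs" "{x, y} \<in> L" "{\<alpha>, \<beta>} \<in> L" and ne: "{x, y} \<noteq> {\<alpha>, \<beta>}"
  then have equiv: "({x, y}, {\<alpha>, \<beta>}) \<in> pair_equiv V Bs"
    unfolding pair_classes_def
    using quotient_eq_iff[OF equiv_pair_equiv] by metis
  \<comment> \<open>The second equivalence is the first with \<open>\<alpha>\<close> and
    \<open>\<beta>\<close> swapped, since \<open>{\<alpha>, \<beta>}\<close> is unordered.\<close>
  have "({x, \<alpha>}, {y, \<beta>}) \<in> pair_equiv V Bs" "({x, \<beta>}, {y, \<alpha>}) \<in> pair_equiv V Bs"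
    using pair_equiv_exchange[of x y \<alpha> \<beta>] pair_equiv_exchange[of x y \<beta> \<alpha>] equiv ne
    by (simp_all add: insert_commute)
  then show "(\<exists>I\<in>pair_classes V Bs. {x, \<alpha>} \<in> I \<and> {y, \<beta>} \<in> I) \<and>
             (\<exists>J\<in>pair_classes V Bs. {x, \<beta>} \<in> J \<and> {y, \<alpha>} \<in> J)"
    by (auto dest: pair_equiv_in_class)
qed

end

theorem theorem3:
  fixes V :: "'a set" and Bs :: "'a set list" and v b r k \<Lambda> :: nat
  assumes "block_design V Bs v b r k \<Lambda>"
  shows "symmetric_pairs (pair_classes V Bs) \<and>
         (\<forall>n t. system_of_pairs V v n t (pair_classes V Bs) \<longrightarrow>
                symmetric_system_of_pairs V v n t (pair_classes V Bs))"
  using block_design.symmetric_pair_classes[OF assms]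
  by (simp add: symmetric_system_of_pairs_def)

end
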